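(* A positive square matrix $C$ can be written as a commutator $C = AB - BA$ of positive matrices $A$ and $B$ (of the same size) if and only if $C$ is nilpotent. Moreover, in this case we can choose $A$ to be diagonal and $B$ to be permutation similar to a strictly upper-triangular matrix.
   Context: A matrix is positive if all its entries are nonnegative real numbers. Two $n \times n$ matrices $M, N$ are permutation similar if $N = P M P^{-1}$ for some permutation matrix $P$. *)

theory Defs
  imports "Jordan_Normal_Form.Matrix" "HOL-Combinatorics.Permutations"
begin

(* Entrywise positivity, not positive (semi)definiteness. *)
definition positive_mat :: "real mat \<Rightarrow> bool" where
  "positive_mat A \<longleftrightarrow> (\<forall>i < dim_row A. \<forall>j < dim_col A. 0 \<le> A $$ (i,j))"

definition nilpotent_mat :: "'a :: semiring_1 mat \<Rightarrow> bool" where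
  "nilpotent_mat A \<longleftrightarrow> square_mat A \<and> (\<exists>k. A ^\<^sub>m k = 0\<^sub>m (dim_row A) (dim_row A))"

definition strictly_upper_triangular :: "'a :: zero mat \<Rightarrow> bool" where
  "strictly_upper_triangular A \<longleftrightarrow>
     square_mat A \<and> (\<forall>i < dim_row A. \<forall>j \<le> i. A $$ (i,j) = 0)"

(* The column with index j is the unit vector with index p j. *)
definition permutation_mat :: "'a :: zero_neq_one mat \<Rightarrow> bool" where
  "permutation_mat P \<longleftrightarrow>
     (\<exists>n p. p permutes {0..<n} \<and> P = mat n n (\<lambda>(i,j). if i = p j then 1 else 0))"

(* similar_mat_wit N M P Q says that N = P * M * Q, where Q is the inverse of P and all four
   matrices are square of the same size. *)
definition permutation_similar :: "'a :: semiring_1 mat \<Rightarrow> 'a mat \<Rightarrow> bool" where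
  "permutation_similar M N \<longleftrightarrow> (\<exists>P Q. permutation_mat P \<and> similar_mat_wit N M P Q)"

end

theory Submission
  imports Defs
begin

text \<open>
  Both directions pass through the directed graph on the indices of \<open>C\<close> that has an edge from
  \<open>i\<close> to \<open>j\<close> whenever \<open>C $$ (i,j) \<noteq> 0\<close>. For a positive matrix no cancellation can occur in a
  product, so the entries of its powers are nonzero exactly where there are walks; hence
  \<open>C\<close> is nilpotent iff this graph is acyclic, and acyclicity is also equivalent to the existence
  of a rank function \<open>h\<close> on the indices that strictly decreases along every edge.

  If \<open>C = A * B - B * A\<close> with all three matrices positive, then \<open>A * B = B * A + C\<close> is a sum of
  two positive matrices. Expanding a power of the sum and dropping the mixed products, which are
  positive, gives \<open>(B * A)\<^sup>m + C\<^sup>m \<le> (A * B)\<^sup>m\<close> entrywise (\<open>pow_mat_superadditive\<close>). The powers of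
  \<open>A * B\<close> and \<open>B * A\<close> have equal traces, so the trace of \<open>C\<^sup>m\<close> is at most \<open>0\<close>, and therefore \<open>0\<close>,
  for every \<open>m \<ge> 1\<close> (\<open>positive_commutator_trace_pow\<close>). A closed walk of length \<open>m\<close> would put a
  positive entry on the diagonal of \<open>C\<^sup>m\<close>, so there is none.

  Conversely, given a rank function \<open>h\<close>, take \<open>A\<close> diagonal with entries \<open>h i\<close>. The commutator
  then multiplies the entry \<open>(i,j)\<close> of \<open>B\<close> by \<open>h i - h j\<close>, which is positive on every edge, so the
  equation \<open>C = A * B - B * A\<close> can be solved for \<open>B\<close> by division, with a positive result supported
  on the edges. Listing the indices by decreasing rank makes \<open>B\<close> strictly upper triangular
  (\<open>commutator_from_rank\<close>).
\<close>

section \<open>Traces of products\<close>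

definition mat_trace :: "'a :: comm_monoid_add mat \<Rightarrow> 'a" where
  "mat_trace A = (\<Sum>i<dim_row A. A $$ (i,i))"

lemma index_mult_mat_sum:
  assumes "A \<in> carrier_mat n m" "B \<in> carrier_mat m k" "i < n" "j < k"
  shows "(A * B) $$ (i,j) = (\<Sum>l<m. A $$ (i,l) * B $$ (l,j))"
  using assms by (auto simp: scalar_prod_def lessThan_atLeast0 intro!: sum.cong)

lemma mat_trace_add:
  assumes "A \<in> carrier_mat n n" "B \<in> carrier_mat n n"
  shows "mat_trace (A + B) = mat_trace A + mat_trace B"
  using assms by (auto simp: mat_trace_def sum.distrib)

lemma mat_trace_mult_commute:
  fixes A B :: "'a :: comm_semiring_0 mat"
  assumes "A \<in> carrier_mat n m" "B \<in> carrier_mat m n"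
  shows "mat_trace (A * B) = mat_trace (B * A)"
proof -
  have "mat_trace (A * B) = (\<Sum>i<n. \<Sum>l<m. A $$ (i,l) * B $$ (l,i))"
    using assms by (auto simp: mat_trace_def index_mult_mat_sum simp del: index_mult_mat(1))
  also have "\<dots> = (\<Sum>l<m. \<Sum>i<n. B $$ (l,i) * A $$ (i,l))"
    by (subst sum.swap) (simp add: mult.commute)
  also have "\<dots> = mat_trace (B * A)"
    using assms by (auto simp: mat_trace_def index_mult_mat_sum simp del: index_mult_mat(1))
  finally show ?thesis .
qed

lemma pow_mult_shift:
  fixes A B :: "'a :: semiring_1 mat"
  assumes A: "A \<in> carrier_mat n n" and B: "B \<in> carrier_mat n n"
  shows "(A * B) ^\<^sub>m m * A = A * (B * A) ^\<^sub>m m"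
proof (induction m)
  case 0
  then show ?case using assms by simp
next
  case (Suc m)
  have AB: "A * B \<in> carrier_mat n n" and BA: "B * A \<in> carrier_mat n n" using A B by auto
  have "(A * B) ^\<^sub>m Suc m * A = ((A * B) ^\<^sub>m m * A) * (B * A)"
    using A B AB pow_carrier_mat[OF AB, of m]
    by (simp add: assoc_mult_mat[of _ n n _ n _ n])
  also have "\<dots> = A * (B * A) ^\<^sub>m Suc m"
    unfolding Suc.IH using A B BA pow_carrier_mat[OF BA, of m]
    by (simp add: assoc_mult_mat[of _ n n _ n _ n])
  finally show ?case .
qed

text \<open>
  Splitting off the outer factors, \<open>(A B)\<^sup>m\<^sup>+\<^sup>1 = A (B A)\<^sup>m B\<close>, and moving \<open>A\<close> around
  cyclically turns it into \<open>(B A)\<^sup>m B A\<close>.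
\<close>
lemma mat_trace_pow_mult_commute:
  fixes A B :: "'a :: comm_semiring_1 mat"
  assumes A: "A \<in> carrier_mat n n" and B: "B \<in> carrier_mat n n"
  shows "mat_trace ((A * B) ^\<^sub>m Suc m) = mat_trace ((B * A) ^\<^sub>m Suc m)"
proof -
  have AB: "A * B \<in> carrier_mat n n" and BA: "B * A \<in> carrier_mat n n" using A B by auto
  have "(A * B) ^\<^sub>m Suc m = ((A * B) ^\<^sub>m m * A) * B"
    using A B AB pow_carrier_mat[OF AB, of m]
    by (simp add: assoc_mult_mat[of _ n n _ n _ n])
  also have "\<dots> = A * ((B * A) ^\<^sub>m m * B)"
    unfolding pow_mult_shift[OF A B] using A B BA pow_carrier_mat[OF BA, of m]
    by (simp add: assoc_mult_mat[of _ n n _ n _ n])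
  finally have "mat_trace ((A * B) ^\<^sub>m Suc m) = mat_trace (((B * A) ^\<^sub>m m * B) * A)"
    using mat_trace_mult_commute[OF A mult_carrier_mat[OF pow_carrier_mat[OF BA] B]] by simp
  also have "((B * A) ^\<^sub>m m * B) * A = (B * A) ^\<^sub>m Suc m"
    using A B BA pow_carrier_mat[OF BA, of m] by (simp add: assoc_mult_mat[of _ n n _ n _ n])
  finally show ?thesis .
qed

section \<open>Powers of a positive commutator have trace zero\<close>

lemma mult_mat_right_mono:
  fixes M N X :: "real mat"
  assumes "M \<in> carrier_mat n n" "N \<in> carrier_mat n n" "X \<in> carrier_mat n n"
    and "M \<le> N" "positive_mat X"
  shows "M * X \<le> N * X"
proof -
  have "(M * X) $$ (i,j) \<le> (N * X) $$ (i,j)" if "i < n" "j < n" for i j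
    unfolding index_mult_mat_sum[OF assms(1,3) that] index_mult_mat_sum[OF assms(2,3) that]
    using assms that
    by (intro sum_mono mult_right_mono) (auto simp: less_eq_mat_def positive_mat_def)
  with assms(1-3) show ?thesis by (auto simp: less_eq_mat_def simp del: index_mult_mat(1))
qed

lemma positive_mat_mult:
  assumes "A \<in> carrier_mat n n" "B \<in> carrier_mat n n" "positive_mat A" "positive_mat B"
  shows "positive_mat (A * B)"
proof -
  have "0 \<le> (A * B) $$ (i,j)" if "i < n" "j < n" for i j
    unfolding index_mult_mat_sum[OF assms(1,2) that]
    using assms that by (intro sum_nonneg mult_nonneg_nonneg) (auto simp: positive_mat_def)
  with assms(1,2) show ?thesis by (auto simp: positive_mat_def simp del: index_mult_mat(1))
qed

lemma positive_mat_pow: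
  assumes "A \<in> carrier_mat n n" "positive_mat A"
  shows "positive_mat (A ^\<^sub>m m)"
proof (induction m)
  case 0
  then show ?case by (auto simp: positive_mat_def)
next
  case (Suc m)
  then show ?case using positive_mat_mult[OF pow_carrier_mat[OF assms(1)] assms(1)] assms by simp
qed

lemma le_if_add_le:
  fixes M N S :: "real mat"
  assumes "M \<in> carrier_mat n n" "N \<in> carrier_mat n n"
    and "positive_mat M" "positive_mat N" "M + N \<le> S"
  shows "M \<le> S \<and> N \<le> S"
proof -
  have d: "dim_row S = n" "dim_col S = n" using assms by (auto simp: less_eq_mat_def)
  have "M $$ (i,j) \<le> S $$ (i,j) \<and> N $$ (i,j) \<le> S $$ (i,j)" if "i < n" "j < n" for i j
  proof -
    have "M $$ (i,j) + N $$ (i,j) \<le> S $$ (i,j)" "0 \<le> M $$ (i,j)" "0 \<le> N $$ (i,j)"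
      using that assms by (auto simp: less_eq_mat_def positive_mat_def)
    then show ?thesis by linarith
  qed
  with d assms(1,2) show ?thesis by (auto simp: less_eq_mat_def)
qed

lemma mat_trace_mono:
  fixes M N :: "real mat"
  assumes "M \<in> carrier_mat n n" "M \<le> N"
  shows "mat_trace M \<le> mat_trace N"
  using assms unfolding mat_trace_def less_eq_mat_def by (auto intro!: sum_mono)

lemma mat_trace_nonneg:
  "M \<in> carrier_mat n n \<Longrightarrow> positive_mat M \<Longrightarrow> 0 \<le> mat_trace M"
  by (auto simp: mat_trace_def positive_mat_def intro!: sum_nonneg)

text \<open>
  The expansion of \<open>(X + Y)\<^sup>m\<close> contains \<open>X\<^sup>m\<close> and \<open>Y\<^sup>m\<close>, and its other terms are positive. The
  induction avoids the noncommutative expansion: each of \<open>X\<^sup>m\<close> and \<open>Y\<^sup>m\<close> lies below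
  \<open>(X + Y)\<^sup>m\<close>, and these two bounds are multiplied by \<open>X\<close> and by \<open>Y\<close> and then added. For the
  exponent \<open>0\<close> the inequality would read \<open>1 + 1 \<le> 1\<close>, hence the successor.
\<close>
lemma pow_mat_superadditive:
  assumes X: "X \<in> carrier_mat n n" and Y: "Y \<in> carrier_mat n n"
    and pX: "positive_mat X" and pY: "positive_mat Y"
  shows "X ^\<^sub>m Suc m + Y ^\<^sub>m Suc m \<le> (X + Y) ^\<^sub>m Suc m"
proof (induction m)
  case 0
  then show ?case using X Y by simp
next
  case (Suc m)
  define S where "S = (X + Y) ^\<^sub>m Suc m"
  have XY: "X + Y \<in> carrier_mat n n" using X Y by simp
  have S: "S \<in> carrier_mat n n" unfolding S_def by (rule pow_carrier_mat[OF XY])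
  have cX: "X ^\<^sub>m k \<in> carrier_mat n n" and cY: "Y ^\<^sub>m k \<in> carrier_mat n n" for k
    using X Y by (auto intro: pow_carrier_mat)
  have "positive_mat (X ^\<^sub>m Suc m)" "positive_mat (Y ^\<^sub>m Suc m)"
    using positive_mat_pow X Y pX pY by blast+
  then have le: "X ^\<^sub>m Suc m \<le> S" "Y ^\<^sub>m Suc m \<le> S"
    using le_if_add_le[OF cX[of "Suc m"] cY[of "Suc m"]] Suc.IH
    unfolding S_def[symmetric] by blast+
  have "X ^\<^sub>m Suc (Suc m) \<le> S * X" "Y ^\<^sub>m Suc (Suc m) \<le> S * Y"
    using mult_mat_right_mono[OF cX S X le(1) pX] mult_mat_right_mono[OF cY S Y le(2) pY] by simp_all
  then have "X ^\<^sub>m Suc (Suc m) + Y ^\<^sub>m Suc (Suc m) \<le> S * X + S * Y"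
    using S X Y cX[of "Suc (Suc m)"] cY[of "Suc (Suc m)"] unfolding less_eq_mat_def
    by (auto simp del: pow_mat.simps index_mult_mat(1) intro!: add_mono)
  also have "S * X + S * Y = (X + Y) ^\<^sub>m Suc (Suc m)"
    using S X Y by (simp add: S_def mult_add_distrib_mat[of _ n n _ n])
  finally show ?case .
qed

text \<open>
  With \<open>A * B = B * A + C\<close>, superadditivity bounds the trace of \<open>C\<^sup>m\<close> by the difference of the
  traces of \<open>(A * B)\<^sup>m\<close> and \<open>(B * A)\<^sup>m\<close>, which vanishes.
\<close>
lemma positive_commutator_trace_pow:
  assumes A: "A \<in> carrier_mat n n" and B: "B \<in> carrier_mat n n"
    and pA: "positive_mat A" and pB: "positive_mat B"
    and pC: "positive_mat (A * B - B * A)"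
  shows "mat_trace ((A * B - B * A) ^\<^sub>m Suc m) = 0"
proof -
  define C where "C = A * B - B * A"
  have BA: "B * A \<in> carrier_mat n n" and AB: "A * B \<in> carrier_mat n n"
    and C: "C \<in> carrier_mat n n" using A B by (auto simp: C_def minus_carrier_mat)
  have sum: "B * A + C = A * B"
    using A B AB BA by (intro eq_matI) (auto simp: C_def simp del: index_mult_mat(1))
  have le: "(B * A) ^\<^sub>m Suc m + C ^\<^sub>m Suc m \<le> (A * B) ^\<^sub>m Suc m"
    using pow_mat_superadditive[OF BA C positive_mat_mult[OF B A pB pA], of m] pC
    unfolding sum by (simp add: C_def)
  have cs: "(B * A) ^\<^sub>m Suc m \<in> carrier_mat n n" "C ^\<^sub>m Suc m \<in> carrier_mat n n"
    "(A * B) ^\<^sub>m Suc m \<in> carrier_mat n n"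
    using pow_carrier_mat AB BA C by blast+
  have "mat_trace ((B * A) ^\<^sub>m Suc m + C ^\<^sub>m Suc m) \<le> mat_trace ((A * B) ^\<^sub>m Suc m)"
    using mat_trace_mono[OF add_carrier_mat[OF cs(2)] le] by blast
  then have "mat_trace (C ^\<^sub>m Suc m) \<le> 0"
    unfolding mat_trace_add[OF cs(1,2)] mat_trace_pow_mult_commute[OF A B] by simp
  moreover have "0 \<le> mat_trace (C ^\<^sub>m Suc m)"
    using mat_trace_nonneg[OF cs(2) positive_mat_pow[OF C]] pC by (simp add: C_def)
  ultimately show ?thesis by (simp add: C_def)
qed

section \<open>Nilpotency and the acyclic graph of nonzero entries\<close>

definition support_rel :: "real mat \<Rightarrow> (nat \<times> nat) set" where
  "support_rel C = {(i,j). i < dim_row C \<and> j < dim_col C \<and> C $$ (i,j) \<noteq> 0}"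

lemma positive_mat_mult_entry_pos:
  assumes "A \<in> carrier_mat n n" "B \<in> carrier_mat n n" "positive_mat A" "positive_mat B"
    and "i < n" "l < n" "j < n" "A $$ (i,l) > 0" "B $$ (l,j) > 0"
  shows "(A * B) $$ (i,j) > 0"
proof -
  have "(A * B) $$ (i,j) = (\<Sum>l<n. A $$ (i,l) * B $$ (l,j))"
    using assms by (simp add: index_mult_mat_sum del: index_mult_mat(1))
  also have "\<dots> > 0"
    using assms by (intro sum_pos2[of _ l]) (auto simp: positive_mat_def)
  finally show ?thesis .
qed

text \<open>
  A walk of length \<open>m\<close> contributes the product of the entries along its edges to the entry of
  \<open>C\<^sup>m\<close>, and positivity excludes that other walks cancel this contribution.
\<close>
lemma trancl_support_rel_imp_pow_pos:
  assumes C: "C \<in> carrier_mat n n" and pC: "positive_mat C"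
    and "(i,j) \<in> (support_rel C)\<^sup>+"
  shows "i < n \<and> j < n \<and> (\<exists>m. (C ^\<^sub>m Suc m) $$ (i,j) > 0)"
  using assms(3)
proof (induction rule: trancl_induct)
  case (base j)
  then have "i < n" "j < n" "C $$ (i,j) > 0"
    using C pC by (auto simp: support_rel_def positive_mat_def order.strict_iff_order)
  then show ?case using C by (auto intro!: exI[of _ 0])
next
  case (step l j)
  then obtain m where l: "i < n" "l < n" "(C ^\<^sub>m Suc m) $$ (i,l) > 0" by auto
  have j: "j < n" "C $$ (l,j) > 0"
    using step.hyps C pC by (auto simp: support_rel_def positive_mat_def order.strict_iff_order)
  have "(C ^\<^sub>m Suc m * C) $$ (i,j) > 0"
    by (rule positive_mat_mult_entry_pos[OF pow_carrier_mat[OF C] C positive_mat_pow[OF C pC] pC])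
      (use l j in auto)
  then show ?case using l j by (metis pow_mat.simps(2))
qed

lemma mat_trace_pos:
  assumes "M \<in> carrier_mat n n" "positive_mat M" "i < n" "M $$ (i,i) > 0"
  shows "mat_trace M > 0"
  unfolding mat_trace_def
  using assms by (intro sum_pos2[of _ i]) (auto simp: positive_mat_def)

lemma acyclic_if_trace_pow_zero:
  assumes C: "C \<in> carrier_mat n n" and pC: "positive_mat C"
    and tr: "\<And>m. mat_trace (C ^\<^sub>m Suc m) = 0"
  shows "acyclic (support_rel C)"
proof (rule acyclicI, intro allI notI)
  fix i assume "(i,i) \<in> (support_rel C)\<^sup>+"
  then obtain m where i: "i < n" and pos: "(C ^\<^sub>m Suc m) $$ (i,i) > 0"
    using trancl_support_rel_imp_pow_pos[OF C pC] by blast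
  have "mat_trace (C ^\<^sub>m Suc m) > 0"
    by (rule mat_trace_pos[OF pow_carrier_mat[OF C] positive_mat_pow[OF C pC] i pos])
  with tr[of m] show False by simp
qed

text \<open>
  A cycle through \<open>i\<close> can be traversed for ever, so it gives walks from \<open>i\<close> of every length, and
  no power of \<open>C\<close> vanishes.
\<close>
lemma acyclic_if_nilpotent:
  assumes C: "C \<in> carrier_mat n n" and pC: "positive_mat C" and "nilpotent_mat C"
  shows "acyclic (support_rel C)"
proof (rule acyclicI, intro allI notI)
  fix i assume "(i,i) \<in> (support_rel C)\<^sup>+"
  then have i: "i < n" using trancl_support_rel_imp_pow_pos[OF C pC] by blast
  \<comment> \<open>The way back from \<open>j\<close> to \<open>i\<close> is kept in the invariant so that the walk can always be extended.\<close>
  have walk: "\<exists>j<n. (j,i) \<in> (support_rel C)\<^sup>+ \<and> (C ^\<^sub>m m) $$ (i,j) > 0" for m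
  proof (induction m)
    case 0
    then show ?case using i C \<open>(i,i) \<in> _\<close> by (auto intro!: exI[of _ i])
  next
    case (Suc m)
    then obtain j where j: "j < n" "(j,i) \<in> (support_rel C)\<^sup>+"
      "(C ^\<^sub>m m) $$ (i,j) > 0" by blast
    obtain l where l: "(j,l) \<in> support_rel C" "(l,i) \<in> (support_rel C)\<^sup>*"
      using j(2) by (meson tranclD)
    then have "l < n" "C $$ (j,l) > 0"
      using C pC by (auto simp: support_rel_def positive_mat_def order.strict_iff_order)
    moreover have "(l,i) \<in> (support_rel C)\<^sup>+"
      using l(2) \<open>(i,i) \<in> _\<close> by (rule rtrancl_trancl_trancl)
    moreover have "(C ^\<^sub>m m * C) $$ (i,l) > 0"
      by (rule positive_mat_mult_entry_pos[OF pow_carrier_mat[OF C] C positive_mat_pow[OF C pC] pC])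
        (use i j calculation in auto)
    ultimately show ?case by auto
  qed
  obtain k where "C ^\<^sub>m k = 0\<^sub>m n n"
    using \<open>nilpotent_mat C\<close> C by (auto simp: nilpotent_mat_def)
  with walk[of k] i show False by auto
qed

text \<open>
  The number of vertices reachable from a vertex is such a rank: along an edge \<open>(i,j)\<close> the
  reachable set can only shrink, and it loses \<open>j\<close>, which cannot be reached from itself.
\<close>
lemma acyclic_imp_rank:
  assumes fin: "finite r" and acyc: "acyclic r"
  obtains h :: "'a \<Rightarrow> nat" where "\<And>i j. (i,j) \<in> r \<Longrightarrow> h j < h i"
proof
  fix i j assume ij: "(i,j) \<in> r"
  have "r\<^sup>+ `` {j} \<subset> r\<^sup>+ `` {i}"
  proof
    show "r\<^sup>+ `` {j} \<subseteq> r\<^sup>+ `` {i}" using ij by (auto intro: trancl_into_trancl2)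
    show "r\<^sup>+ `` {j} \<noteq> r\<^sup>+ `` {i}" using ij acyc by (auto simp: acyclic_def)
  qed
  moreover have "finite (r\<^sup>+ `` {i})" using fin by (simp add: finite_Image)
  ultimately show "card (r\<^sup>+ `` {j}) < card (r\<^sup>+ `` {i})" by (rule psubset_card_mono[rotated])
qed

lemma support_rank:
  assumes C: "C \<in> carrier_mat n n" and "acyclic (support_rel C)"
  obtains h :: "nat \<Rightarrow> nat" where
    "\<And>i j. i < n \<Longrightarrow> j < n \<Longrightarrow> C $$ (i,j) \<noteq> 0 \<Longrightarrow> h j < h i"
proof -
  have "support_rel C \<subseteq> {..<n} \<times> {..<n}" using C by (auto simp: support_rel_def)
  then have "finite (support_rel C)" by (rule finite_subset) auto
  from acyclic_imp_rank[OF this assms(2)] obtain h :: "nat \<Rightarrow> nat"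
    where "\<And>i j. (i,j) \<in> support_rel C \<Longrightarrow> h j < h i" by blast
  with C show ?thesis by (intro that[of h]) (auto simp: support_rel_def)
qed

text \<open>
  Every factor in a nonzero product of entries along a walk costs at least one unit of rank, so
  a walk cannot be longer than the largest rank.
\<close>
lemma nilpotent_if_rank:
  fixes h :: "nat \<Rightarrow> nat"
  assumes C: "C \<in> carrier_mat n n"
    and h: "\<And>i j. i < n \<Longrightarrow> j < n \<Longrightarrow> C $$ (i,j) \<noteq> 0 \<Longrightarrow> h j < h i"
  shows "nilpotent_mat C"
proof -
  have drop: "h j + m \<le> h i" if "i < n" "j < n" "(C ^\<^sub>m m) $$ (i,j) \<noteq> 0" for m i j
    using that
  proof (induction m arbitrary: j)
    case 0
    then show ?case using C by (auto split: if_splits)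
  next
    case (Suc m)
    have "(\<Sum>l<n. (C ^\<^sub>m m) $$ (i,l) * C $$ (l,j)) \<noteq> 0"
      using Suc.prems index_mult_mat_sum[OF pow_carrier_mat[OF C] C, of i j m] by simp
    then obtain l where l: "l < n" "(C ^\<^sub>m m) $$ (i,l) * C $$ (l,j) \<noteq> 0"
      by (metis (no_types, lifting) lessThan_iff sum.neutral)
    then have "(C ^\<^sub>m m) $$ (i,l) \<noteq> 0" "C $$ (l,j) \<noteq> 0" by (metis mult_zero_left mult_zero_right)+
    then have "h l + m \<le> h i" "h j < h l"
      using Suc.IH[of l] Suc.prems l(1) h[of l j] by auto
    then show ?case by simp
  qed
  \<comment> \<open>Any number above all ranks serves; the sum bounds each of them even if \<open>n = 0\<close>.\<close>
  define k where "k = Suc (\<Sum>i<n. h i)"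
  have "h i < k" if "i < n" for i
    unfolding k_def using that by (simp add: less_Suc_eq_le member_le_sum)
  then have "(C ^\<^sub>m k) $$ (i,j) = 0" if "i < n" "j < n" for i j
    using drop[of i j k] that by fastforce
  then have "C ^\<^sub>m k = 0\<^sub>m n n"
    using C by (intro eq_matI) auto
  then show ?thesis using C by (auto simp: nilpotent_mat_def)
qed

section \<open>Writing a matrix with decreasing rank as a commutator\<close>

lemma sorting_permutation:
  fixes h :: "nat \<Rightarrow> nat"
  obtains p where "p permutes {0..<n}" "\<And>i j. i \<le> j \<Longrightarrow> j < n \<Longrightarrow> h (p j) \<le> h (p i)"
proof -
  define xs where "xs = rev (sort_key h [0..<n])"
  define p where "p = (\<lambda>i. if i < n then xs ! i else i)"
  have xs: "length xs = n" "set xs = {0..<n}" "distinct xs" by (auto simp: xs_def)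
  have "bij_betw ((!) xs) {0..<n} {0..<n}"
    by (rule bij_betw_nth[OF xs(3)]) (simp_all only: xs(1,2) lessThan_atLeast0)
  then have "bij_betw p {0..<n} {0..<n}"
    by (rule bij_betw_cong[THEN iffD1, rotated]) (simp add: p_def)
  then have "p permutes {0..<n}" by (rule bij_imp_permutes) (auto simp: p_def)
  moreover have "h (p j) \<le> h (p i)" if "i \<le> j" "j < n" for i j
  proof -
    have "sorted (rev (map h xs))" by (simp add: xs_def rev_map)
    then have "map h xs ! j \<le> map h xs ! i"
      using that xs(1) by (intro sorted_rev_nth_mono) auto
    with that xs(1) show ?thesis by (simp add: p_def)
  qed
  ultimately show ?thesis by (rule that)
qed

text \<open>
  Relabelling rows and columns simultaneously by \<open>p\<close> is a conjugation. Since the column \<open>j\<close> of the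
  permutation matrix of \<open>p\<close> is the unit vector at \<open>p j\<close>, multiplying by it on the right
  relabels columns by \<open>p\<close>, but to relabel rows by \<open>p\<close> from the left the matrix of the inverse
  permutation is required.
\<close>
lemma permutation_similar_reindex:
  fixes M :: "'a :: semiring_1 mat"
  assumes M: "M \<in> carrier_mat n n" and p: "p permutes {0..<n}"
  shows "permutation_similar M (mat n n (\<lambda>(i,j). M $$ (p i, p j)))"
proof -
  let ?T = "mat n n (\<lambda>(i,j). M $$ (p i, p j))"
  define q where "q = inv_into UNIV p"
  have q: "q permutes {0..<n}" unfolding q_def by (rule permutes_inv[OF p])
  have pq: "p (q i) = i" "q (p i) = i" for i
    unfolding q_def by (rule permutes_inverses[OF p])+
  define P :: "'a mat" where "P = mat n n (\<lambda>(i,j). if i = q j then 1 else 0)"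
  define Q :: "'a mat" where "Q = mat n n (\<lambda>(i,j). if i = p j then 1 else 0)"
  have P: "P \<in> carrier_mat n n" and Q: "Q \<in> carrier_mat n n" by (auto simp: P_def Q_def)
  have lt: "p i < n" if "i < n" for i using permutes_in_image[OF p, of i] that by simp
  have inv: "i = q j \<longleftrightarrow> j = p i" for i j using pq by metis
  have mulP: "(P * X) $$ (i,j) = X $$ (p i, j)" if "X \<in> carrier_mat n n" "i < n" "j < n" for X i j
  proof -
    have "(P * X) $$ (i,j) = (\<Sum>l<n. if l = p i then X $$ (l,j) else 0)"
      using that P unfolding index_mult_mat_sum[OF P that]
      by (intro sum.cong) (auto simp: P_def inv)
    then show ?thesis using lt[OF that(2)] by simp
  qed
  have mulQ: "(X * Q) $$ (i,j) = X $$ (i, p j)" if "X \<in> carrier_mat n n" "i < n" "j < n" for X i j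
  proof -
    have "(X * Q) $$ (i,j) = (\<Sum>l<n. if l = p j then X $$ (i,l) else 0)"
      using that Q unfolding index_mult_mat_sum[OF that(1) Q that(2,3)]
      by (intro sum.cong) (auto simp: Q_def)
    then show ?thesis using lt[OF that(3)] by simp
  qed
  have PQ: "P * Q = 1\<^sub>m n"
  proof (rule eq_matI)
    fix i j assume "i < dim_row (1\<^sub>m n :: 'a mat)" "j < dim_col (1\<^sub>m n :: 'a mat)"
    then show "(P * Q) $$ (i,j) = 1\<^sub>m n $$ (i,j)"
      using mulP[OF Q, of i j] lt permutes_inj[OF p] by (auto simp: Q_def inj_def)
  qed (use P Q in auto)
  have QP: "Q * P = 1\<^sub>m n"
  proof (rule eq_matI)
    fix i j assume "i < dim_row (1\<^sub>m n :: 'a mat)" "j < dim_col (1\<^sub>m n :: 'a mat)"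
    then show "(Q * P) $$ (i,j) = 1\<^sub>m n $$ (i,j)"
      using index_mult_mat_sum[OF Q P, of i j] permutes_in_image[OF q, of j] pq
      by (auto simp: Q_def P_def if_distrib[of "\<lambda>x. x * _"] if_distrib[of "\<lambda>x. _ * x"] sum.delta cong: if_cong)
  qed (use P Q in auto)
  have T: "?T = P * M * Q"
  proof (rule eq_matI)
    fix i j assume "i < dim_row (P * M * Q)" "j < dim_col (P * M * Q)"
    then have ij: "i < n" "j < n" using P Q by auto
    show "?T $$ (i,j) = (P * M * Q) $$ (i,j)"
      using mulQ[OF mult_carrier_mat[OF P M] ij] mulP[OF M ij(1) lt[OF ij(2)]] ij by simp
  qed (use P Q in auto)
  have "permutation_mat P"
    unfolding permutation_mat_def P_def using q by blast
  moreover have "similar_mat_wit ?T M P Q"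
    using M P Q PQ QP T by (auto simp: similar_mat_wit_def Let_def)
  ultimately show ?thesis unfolding permutation_similar_def by blast
qed

text \<open>
  Commutation with a diagonal matrix acts on each entry separately, as multiplication by the
  difference of two diagonal entries; with the ranks on the diagonal this difference is positive
  wherever \<open>C\<close> has a nonzero entry.
\<close>
lemma commutator_from_rank:
  fixes h :: "nat \<Rightarrow> nat" and C :: "real mat"
  assumes C: "C \<in> carrier_mat n n" and pC: "positive_mat C"
    and h: "\<And>i j. i < n \<Longrightarrow> j < n \<Longrightarrow> C $$ (i,j) \<noteq> 0 \<Longrightarrow> h j < h i"
  shows "\<exists>A \<in> carrier_mat n n. \<exists>B \<in> carrier_mat n n.
             positive_mat A \<and> positive_mat B \<and> C = A * B - B * A \<and>
             diagonal_mat A \<and>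
             (\<exists>T. strictly_upper_triangular T \<and> permutation_similar B T)"
proof -
  define A :: "real mat" where "A = mat n n (\<lambda>(i,j). if i = j then real (h i) else 0)"
  \<comment> \<open>If \<open>h i = h j\<close>, then \<open>C $$ (i,j) = 0\<close> and the quotient is \<open>0\<close> by the convention for division.\<close>
  define B where "B = mat n n (\<lambda>(i,j). C $$ (i,j) / (real (h i) - real (h j)))"
  have A: "A \<in> carrier_mat n n" and B: "B \<in> carrier_mat n n" by (auto simp: A_def B_def)
  have pA: "positive_mat A" by (auto simp: A_def positive_mat_def)
  have "0 \<le> B $$ (i,j)" if "i < n" "j < n" for i j
  proof (cases "C $$ (i,j) = 0")
    case False
    then show ?thesis using h[OF that] that pC C by (auto simp: B_def positive_mat_def)
  qed (use that in \<open>simp add: B_def\<close>)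
  then have pB: "positive_mat B" using B by (auto simp: positive_mat_def)
  have AB: "(A * B) $$ (i,j) = real (h i) * B $$ (i,j)" if "i < n" "j < n" for i j
  proof -
    have "(A * B) $$ (i,j) = (\<Sum>l<n. if l = i then real (h i) * B $$ (l,j) else 0)"
      unfolding index_mult_mat_sum[OF A B that]
      using that by (intro sum.cong) (auto simp: A_def)
    then show ?thesis using that by simp
  qed
  have BA: "(B * A) $$ (i,j) = B $$ (i,j) * real (h j)" if "i < n" "j < n" for i j
  proof -
    have "(B * A) $$ (i,j) = (\<Sum>l<n. if l = j then B $$ (i,l) * real (h j) else 0)"
      unfolding index_mult_mat_sum[OF B A that]
      using that by (intro sum.cong) (auto simp: A_def)
    then show ?thesis using that by simp
  qed
  have entry: "C $$ (i,j) = real (h i) * B $$ (i,j) - B $$ (i,j) * real (h j)" if "i < n" "j < n" for i j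
  proof (cases "C $$ (i,j) = 0")
    case False
    then have "real (h i) - real (h j) \<noteq> 0" using h[OF that] by simp
    then have "C $$ (i,j) = (real (h i) - real (h j)) * B $$ (i,j)" using that by (simp add: B_def)
    then show ?thesis by (simp add: algebra_simps)
  qed (use that in \<open>simp add: B_def\<close>)
  have CAB: "C = A * B - B * A"
    using A B C by (intro eq_matI) (auto simp: AB BA entry simp del: index_mult_mat(1))
  obtain p where p: "p permutes {0..<n}" and mono: "\<And>i j. i \<le> j \<Longrightarrow> j < n \<Longrightarrow> h (p j) \<le> h (p i)"
    using sorting_permutation[where h = h and n = n] by blast
  define T where "T = mat n n (\<lambda>(i,j). B $$ (p i, p j))"
  \<comment> \<open>Decreasing order: a nonzero entry lowers the rank from row to column, so its column comes later.\<close>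
  have "T $$ (i,j) = 0" if "i < n" "j \<le> i" for i j
  proof -
    have "p i < n" "p j < n" using permutes_in_image[OF p] that by auto
    moreover have "\<not> h (p j) < h (p i)" using mono[of j i] that by simp
    ultimately have "C $$ (p i, p j) = 0" using h by blast
    with \<open>p i < n\<close> \<open>p j < n\<close> that show ?thesis by (simp add: T_def B_def)
  qed
  then have "strictly_upper_triangular T"
    by (auto simp: strictly_upper_triangular_def T_def)
  moreover have "permutation_similar B T"
    unfolding T_def by (rule permutation_similar_reindex[OF B p])
  moreover have "diagonal_mat A" by (auto simp: diagonal_mat_def A_def)
  ultimately show ?thesis using A B pA pB CAB by blast
qed

theorem corollary3p2:
  fixes C :: "real mat" and n :: nat
  assumes "C \<in> carrier_mat n n" and "positive_mat C"
  shows "((\<exists>A \<in> carrier_mat n n. \<exists>B \<in> carrier_mat n n.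
             positive_mat A \<and> positive_mat B \<and> C = A * B - B * A)
          \<longleftrightarrow> nilpotent_mat C)
       \<and> (nilpotent_mat C \<longrightarrow>
           (\<exists>A \<in> carrier_mat n n. \<exists>B \<in> carrier_mat n n.
             positive_mat A \<and> positive_mat B \<and> C = A * B - B * A \<and>
             diagonal_mat A \<and>
             (\<exists>T. strictly_upper_triangular T \<and> permutation_similar B T)))"
proof -
  have "nilpotent_mat C"
    if "A \<in> carrier_mat n n" "B \<in> carrier_mat n n" "positive_mat A" "positive_mat B"
      "C = A * B - B * A" for A B
  proof -
    have "mat_trace (C ^\<^sub>m Suc m) = 0" for m
      using positive_commutator_trace_pow[OF that(1-4)] assms(2) that(5) by simp
    then have "acyclic (support_rel C)" using acyclic_if_trace_pow_zero assms by blast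
    then obtain h :: "nat \<Rightarrow> nat"
      where "\<And>i j. i < n \<Longrightarrow> j < n \<Longrightarrow> C $$ (i,j) \<noteq> 0 \<Longrightarrow> h j < h i"
      using support_rank assms(1) by blast
    then show ?thesis by (rule nilpotent_if_rank[OF assms(1)])
  qed
  moreover have "\<exists>A \<in> carrier_mat n n. \<exists>B \<in> carrier_mat n n.
             positive_mat A \<and> positive_mat B \<and> C = A * B - B * A \<and>
             diagonal_mat A \<and>
             (\<exists>T. strictly_upper_triangular T \<and> permutation_similar B T)" if nil: "nilpotent_mat C"
  proof -
    obtain h :: "nat \<Rightarrow> nat"
      where "\<And>i j. i < n \<Longrightarrow> j < n \<Longrightarrow> C $$ (i,j) \<noteq> 0 \<Longrightarrow> h j < h i"
      using support_rank assms(1) acyclic_if_nilpotent[OF assms nil] by blast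
    then show ?thesis by (rule commutator_from_rank[OF assms])
  qed
  ultimately show ?thesis by blast
qed

end
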